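(* The following statements hold. (1) $\tau(H_5)=\frac76$ whenever $p\ge 6$. (2) $\tau(H_{12})=1$ (for every $p\ge 3$).
   Context: All graphs are finite, simple and undirected. $c(G)$ is the number of components of $G$; $G$ is $t$-tough if $t\cdot c(G-W)\le |W|$ for every cutset $W$ (every $W\subseteq V(G)$ with $c(G-W)\ge2$). For non-complete $G$, the toughness $\tau(G)$ is the maximum $t$ such that $G$ is $t$-tough. For $p\ge5$, $H_5$ is obtained from a complete graph $K_p$ with distinct vertices $y_1,\dots,y_5\in V(K_p)$, and new vertices $x_1,x_2,t_1,\dots,t_5$, by adding the edges $t_ix_j$ and $t_iy_i$ for all $i\in\{1,\dots,5\}$, $j\in\{1,2\}$. For $p\ge3$, $H_{12}$ is obtained from a complete graph $K_p$ with distinct vertices $y_1,y_2,y_3\in V(K_p)$, and new vertices $x,t_1,t_2,t_3$, by adding the edges $t_ix$ and $t_iy_i$ for $i\in\{1,2,3\}$. *)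

theory Defs
  imports Complex_Main "Graph_Theory.Graph_Theory"
begin

text \<open>
  Finite simple undirected graphs are the symmetric, loop-free digraphs of \<^locale>\<open>graph\<close>.
\<close>

definition num_components :: "('a, 'b) pre_digraph \<Rightarrow> nat" where
  "num_components G = card {H. pre_digraph.max_subgraph G Digraph_Component.connected H}"

lemma (in wf_digraph) strongly_connected_imp_connected:
  "strongly_connected G \<Longrightarrow> Digraph_Component.connected G"
  by (auto simp: Digraph_Component.connected_def strongly_connected_def
      intro: reachable_mk_symmetricI)

lemma num_components_conv_sccs:
  assumes "graph G"
  shows "num_components G = card (pre_digraph.sccs G)"
proof -
  interpret graph G by fact
  have "max_subgraph Digraph_Component.connected H \<longleftrightarrow> H \<in> sccs" for H
  proof
    assume H: "max_subgraph Digraph_Component.connected H"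
    then have sub: "subgraph H G" and con: "Digraph_Component.connected H"
      and mx: "\<And>H'. H' \<noteq> H \<Longrightarrow> subgraph H H' \<Longrightarrow> subgraph H' G \<Longrightarrow> \<not> Digraph_Component.connected H'"
      unfolding max_subgraph_def by auto
    let ?I = "G \<restriction> verts H"
    have vs: "verts H \<subseteq> verts G" using sub by auto
    have ind: "induced_subgraph ?I G" using vs by (rule induced_induce)
    have HI: "subgraph H ?I" using sub by (rule subgraph_induce_subgraphI2)
    interpret I: wf_digraph ?I using ind by auto
    have conI: "Digraph_Component.connected ?I"
      using I.connected_spanning_imp_connected[of H] HI con by (auto simp: spanning_def)
    have eq: "?I = H" using mx[OF _ HI _] ind conI by blast
    have sc: "strongly_connected ?I"
      using I.symmetric_connected_imp_strongly_connected conI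
        induced_graph_imp_symmetric[OF sym_arcs ind] by blast
    have "max_subgraph strongly_connected H"
      unfolding max_subgraph_def
    proof (intro conjI allI impI notI)
      fix H' assume A: "H' \<noteq> H \<and> subgraph H H'" "subgraph H' G \<and> strongly_connected H'"
      then interpret H': wf_digraph H' by blast
      have "Digraph_Component.connected H'"
        using A H'.strongly_connected_imp_connected by blast
      then show False using mx A by blast
    qed (use sub sc eq in auto)
    then show "H \<in> sccs" by (simp add: sccs_altdef2)
  next
    assume H: "H \<in> sccs"
    then have ms: "max_subgraph strongly_connected H" by (simp add: sccs_altdef2)
    then have sub: "subgraph H G" and sc: "strongly_connected H"
      and mx: "\<And>H'. H' \<noteq> H \<Longrightarrow> subgraph H H' \<Longrightarrow> subgraph H' G \<Longrightarrow> \<not> strongly_connected H'"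
      unfolding max_subgraph_def by auto
    interpret H: wf_digraph H using sub by auto
    show "max_subgraph Digraph_Component.connected H"
      unfolding max_subgraph_def
    proof (intro conjI allI impI notI)
      show "Digraph_Component.connected H" using sc H.strongly_connected_imp_connected by blast
      fix H' assume A: "H' \<noteq> H \<and> subgraph H H'" "subgraph H' G \<and> Digraph_Component.connected H'"
      let ?I = "G \<restriction> verts H'"
      have vs: "verts H' \<subseteq> verts G" using A by auto
      have ind: "induced_subgraph ?I G" using vs by (rule induced_induce)
      have HI: "subgraph H' ?I" using A subgraph_induce_subgraphI2 by blast
      interpret I: wf_digraph ?I using ind by auto
      have "Digraph_Component.connected ?I"
        using I.connected_spanning_imp_connected[of H'] HI A by (auto simp: spanning_def)
      then have scI: "strongly_connected ?I"
        using I.symmetric_connected_imp_strongly_connected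
          induced_graph_imp_symmetric[OF sym_arcs ind] by blast
      have HI2: "subgraph H ?I" using A HI subgraph_trans by blast
      have "H = ?I" using mx[OF _ HI2] scI ind by blast
      then have "subgraph H' H" using HI by simp
      then have "H' = H" using A by (auto simp: subgraph_def compatible_def intro: pre_digraph.equality)
      then show False using A by blast
    qed (use sub in auto)
  qed
  then show ?thesis by (simp add: num_components_def)
qed

definition delete_verts :: "('a, 'b) pre_digraph \<Rightarrow> 'a set \<Rightarrow> ('a, 'b) pre_digraph" where
  "delete_verts G W = G \<restriction> (verts G - W)"

definition cutset :: "('a, 'b) pre_digraph \<Rightarrow> 'a set \<Rightarrow> bool" where
  "cutset G W \<longleftrightarrow> W \<subseteq> verts G \<and> num_components (delete_verts G W) \<ge> 2"

definition tough :: "real \<Rightarrow> ('a, 'b) pre_digraph \<Rightarrow> bool" where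
  "tough t G \<longleftrightarrow> (\<forall>W. cutset G W \<longrightarrow> t * real (num_components (delete_verts G W)) \<le> real (card W))"

text \<open>
  Meaningful for non-complete graphs only, where the maximum is attained
  (see \<open>tough_iff_le_toughness\<close> below). A complete graph has no cutset, is therefore
  \<open>t\<close>-tough for every \<open>t\<close>, and the value is then unspecified.
\<close>

definition toughness :: "('a, 'b) pre_digraph \<Rightarrow> real" where
  "toughness G = (GREATEST t. tough t G)"

lemma cutset_of_nonadjacent:
  assumes "graph G" "u \<in> verts G" "v \<in> verts G" "u \<noteq> v" "(u, v) \<notin> arcs_ends G"
  shows "cutset G (verts G - {u, v})"
proof -
  interpret graph G by fact
  let ?D = "delete_verts G (verts G - {u, v})"
  have D: "?D = G \<restriction> {u, v}"
    using assms(2,3) by (auto simp: delete_verts_def intro: arg_cong[where f = "induce_subgraph G"])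
  have ind: "induced_subgraph ?D G" unfolding D using assms(2,3) by (intro induced_induce) auto
  interpret D: digraph ?D using ind by (rule digraphI_induced)
  have gD: "graph ?D"
    using D.graphI induced_graph_imp_symmetric[OF sym_arcs ind] by blast
  have "(v, u) \<notin> arcs_ends G"
    using assms(5) sym_arcs by (auto simp: symmetric_def sym_def)
  then have ends: "arcs_ends ?D = {}"
    using assms(5) no_loops unfolding D by (auto simp: arcs_ends_conv induce_subgraph_def image_iff)
  have reach: "a \<rightarrow>\<^sup>*\<^bsub>?D\<^esub> b \<longleftrightarrow> a = b \<and> a \<in> {u, v}" for a b
  proof -
    have "a = b" if "a \<rightarrow>\<^sup>*\<^bsub>?D\<^esub> b"
      using that unfolding reachable_def ends by (induct rule: rtrancl_on.induct) auto
    then show ?thesis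
      using D.reachable_in_verts(1)[of a b] D.reachable_refl[of a] unfolding D by auto
  qed
  have "{{u}, {v}} \<subseteq> D.sccs_verts"
    by (auto simp: D.in_sccs_verts_conv_reachable reach)
  moreover have "finite D.sccs_verts"
  proof (rule finite_subset)
    show "D.sccs_verts \<subseteq> Pow {u, v}"
      unfolding D.sccs_verts_def reach by blast
  qed simp
  ultimately have "card {{u}, {v}} \<le> card D.sccs_verts" by (metis card_mono)
  then have "2 \<le> num_components ?D"
    using assms(4) by (simp add: num_components_conv_sccs[OF gD] D.card_sccs_verts)
  then show ?thesis by (simp add: cutset_def)
qed

lemma tough_iff_le_toughness:
  assumes "graph G" and nc: "\<not> complete_digraph (card (verts G)) G"
  shows "tough t G \<longleftrightarrow> t \<le> toughness G"
proof -
  interpret graph G by fact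
  have "\<exists>u v. u \<in> verts G \<and> v \<in> verts G \<and> u \<noteq> v \<and> (u, v) \<notin> arcs_ends G"
  proof (rule ccontr)
    assume "\<not> ?thesis"
    then have "arcs_ends G = {(u, v). (u, v) \<in> verts G \<times> verts G \<and> u \<noteq> v}"
      using no_loops by (auto simp: arcs_ends_conv)
    then show False using nc \<open>graph G\<close> by (simp add: complete_digraph_def)
  qed
  then obtain W0 where W0: "cutset G W0" using cutset_of_nonadjacent[OF \<open>graph G\<close>] by blast
  let ?R = "(\<lambda>W. real (card W) / real (num_components (delete_verts G W))) ` {W. cutset G W}"
  have "finite {W. cutset G W}"
    by (rule finite_subset[of _ "Pow (verts G)"]) (auto simp: cutset_def)
  then have fin: "finite ?R" and ne: "?R \<noteq> {}" using W0 by auto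
  have iff: "tough s G \<longleftrightarrow> s \<le> Min ?R" for s
    unfolding tough_def Min_ge_iff[OF fin ne]
    by (auto simp: cutset_def pos_le_divide_eq)
  have "toughness G = Min ?R"
    unfolding toughness_def by (rule Greatest_equality) (auto simp: iff)
  then show ?thesis by (simp add: iff)
qed

definition add_verts_edges ::
    "'a pair_pre_digraph \<Rightarrow> 'a set \<Rightarrow> ('a \<times> 'a) set \<Rightarrow> 'a pair_pre_digraph" where
  "add_verts_edges G V E = \<lparr>pverts = pverts G \<union> V, parcs = parcs G \<union> E \<union> E\<inverse>\<rparr>"

text \<open>
  The families are predicates, so that \<open>K\<^sub>p\<close> may be any complete graph on \<open>p\<close> vertices and
  the new vertices any distinct elements outside it. That \<open>p \<ge> 5\<close> (respectively \<open>p \<ge> 3\<close>) is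
  implied by the distinctness of the \<open>y i\<close>.
\<close>

definition is_H5 :: "nat \<Rightarrow> 'a pair_pre_digraph \<Rightarrow> bool" where
  "is_H5 p G \<longleftrightarrow> (\<exists>K (y :: nat \<Rightarrow> 'a) (x :: nat \<Rightarrow> 'a) (t :: nat \<Rightarrow> 'a).
     complete_digraph p (with_proj K) \<and>
     inj_on y {1..5} \<and> y ` {1..5} \<subseteq> pverts K \<and>
     inj_on x {1..2} \<and> inj_on t {1..5} \<and> x ` {1..2} \<inter> t ` {1..5} = {} \<and>
     (x ` {1..2} \<union> t ` {1..5}) \<inter> pverts K = {} \<and>
     G = add_verts_edges K (x ` {1..2} \<union> t ` {1..5})
           ({(t i, x j) | i j. i \<in> {1..5} \<and> j \<in> {1..2}} \<union> {(t i, y i) | i. i \<in> {1..5}}))"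

definition is_H12 :: "nat \<Rightarrow> 'a pair_pre_digraph \<Rightarrow> bool" where
  "is_H12 p G \<longleftrightarrow> (\<exists>K (y :: nat \<Rightarrow> 'a) (x :: 'a) (t :: nat \<Rightarrow> 'a).
     complete_digraph p (with_proj K) \<and>
     inj_on y {1..3} \<and> y ` {1..3} \<subseteq> pverts K \<and>
     inj_on t {1..3} \<and> x \<notin> t ` {1..3} \<and>
     insert x (t ` {1..3}) \<inter> pverts K = {} \<and>
     G = add_verts_edges K (insert x (t ` {1..3}))
           ({(t i, x) | i. i \<in> {1..3}} \<union> {(t i, y i) | i. i \<in> {1..3}}))"

lemma pair_graph_add_verts_edges:
  assumes "complete_digraph p (with_proj K)" "finite V" "finite E"
    and "\<And>a b. (a, b) \<in> E \<Longrightarrow> a \<noteq> b \<and> a \<in> pverts K \<union> V \<and> b \<in> pverts K \<union> V"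
  shows "pair_graph (add_verts_edges K V E)"
proof -
  let ?G = "add_verts_edges K V E"
  interpret K: pair_graph K using assms(1) by (rule pair_graphI_complete)
  have s: "sym (parcs K)" using K.pair_sym_arcs by (simp add: symmetric_def)
  have wf: "a \<noteq> b \<and> a \<in> pverts ?G \<and> b \<in> pverts ?G" if "(a, b) \<in> parcs ?G" for a b
    using that assms(4)[of a b] assms(4)[of b a] K.pair_no_loops[of "(a, b)"]
      K.arc_fst_in_verts[of "(a, b)"] K.arc_snd_in_verts[of "(a, b)"]
    by (auto simp: add_verts_edges_def)
  have "sym (parcs ?G)" using s by (auto simp: sym_def add_verts_edges_def)
  moreover have "finite (pverts ?G)" "finite (parcs ?G)"
    using assms(2,3) K.pair_finite_verts K.pair_finite_arcs by (simp_all add: add_verts_edges_def)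
  ultimately show ?thesis
    using wf by unfold_locales (auto simp: symmetric_def)
qed

lemma is_H5_pair_graph:
  assumes "is_H5 p G" shows "pair_graph G"
proof -
  obtain K y x t where K: "complete_digraph p (with_proj K)" and y: "y ` {1..5} \<subseteq> pverts K"
    and d: "x ` {1..2} \<inter> t ` {1..5} = {}" "(x ` {1..2} \<union> t ` {1..5}) \<inter> pverts K = {}"
    and G: "G = add_verts_edges K (x ` {1..2} \<union> t ` {1..5})
           ({(t i, x j) | i j. i \<in> {1..5::nat} \<and> j \<in> {1..2::nat}} \<union> {(t i, y i) | i. i \<in> {1..5}})"
    using assms unfolding is_H5_def by blast
  show ?thesis
    unfolding G
  proof (rule pair_graph_add_verts_edges[OF K], goal_cases)
    case 1 then show ?case by simp
  next
    case 2 show ?case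
      by (rule finite_subset[of _ "t ` {1..5} \<times> (x ` {1..2} \<union> y ` {1..5})"]) auto
  next
    case (3 a b) then show ?case using y d by blast
  qed
qed

lemma is_H12_pair_graph:
  assumes "is_H12 p G" shows "pair_graph G"
proof -
  obtain K y x t where K: "complete_digraph p (with_proj K)" and y: "y ` {1..3} \<subseteq> pverts K"
    and d: "x \<notin> t ` {1..3}" "insert x (t ` {1..3}) \<inter> pverts K = {}"
    and G: "G = add_verts_edges K (insert x (t ` {1..3}))
           ({(t i, x) | i. i \<in> {1..3::nat}} \<union> {(t i, y i) | i. i \<in> {1..3}})"
    using assms unfolding is_H12_def by blast
  show ?thesis
    unfolding G
  proof (rule pair_graph_add_verts_edges[OF K], goal_cases)
    case 1 then show ?case by simp
  next
    case 2 then show ?case by (simp add: finite_image_set finite_image_set2)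
  next
    case (3 a b) then show ?case using y d by blast
  qed
qed

lemma complete_digraph_lessThan:
  "complete_digraph p (with_proj \<lparr>pverts = {..<p}, parcs = {(u, v). u < p \<and> v < p \<and> u \<noteq> v}\<rparr>)"
  by (simp add: complete_digraph_pair_def)

lemma is_H5_exists:
  assumes "p \<ge> 5" shows "\<exists>G :: nat pair_pre_digraph. is_H5 p G"
  unfolding is_H5_def
  apply (rule exI)
  apply (rule exI[of _ "\<lparr>pverts = {..<p}, parcs = {(u, v). u < p \<and> v < p \<and> u \<noteq> v}\<rparr>"])
  apply (rule exI[of _ "\<lambda>i. i - 1"], rule exI[of _ "\<lambda>j. p + j"], rule exI[of _ "\<lambda>i. p + 2 + i"])
  apply (intro conjI)
         apply (rule complete_digraph_lessThan)
  using assms by (auto simp: inj_on_def)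

lemma is_H12_exists:
  assumes "p \<ge> 3" shows "\<exists>G :: nat pair_pre_digraph. is_H12 p G"
  unfolding is_H12_def
  apply (rule exI)
  apply (rule exI[of _ "\<lparr>pverts = {..<p}, parcs = {(u, v). u < p \<and> v < p \<and> u \<noteq> v}\<rparr>"])
  apply (rule exI[of _ "\<lambda>i. i - 1"], rule exI[of _ "p"], rule exI[of _ "\<lambda>i. p + i"])
  apply (intro conjI)
       apply (rule complete_digraph_lessThan)
  using assms by (auto simp: inj_on_def)

end

theory Submission
  imports Defs
begin

text \<open>
  Both graphs consist of a clique \<open>K\<close>, a set \<open>X\<close> of \<open>k\<close> further vertices, and \<open>n\<close> link vertices
  \<open>t i\<close>, each joined to all of \<open>X\<close> and to its own clique vertex \<open>y i\<close>; the values of \<open>(k, n)\<close> are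
  \<open>(2, 5)\<close> and \<open>(1, 3)\<close>. The toughness is computed for this common shape.

  A cutset \<open>W\<close> is of one of two kinds. If \<open>W\<close> contains \<open>X\<close>, then every component is either the one
  meeting \<open>K\<close> or a single link vertex \<open>t i\<close> with \<open>y i \<in> W\<close>. With \<open>m\<close> such links there are at most
  \<open>m + 1\<close> components, and \<open>W\<close> has at least \<open>k + m\<close> elements. If some vertex of \<open>X\<close> survives, then all
  surviving links hang together with it, so there are at most \<open>k + 1\<close> components. Moreover every path
  from \<open>K\<close> through some \<open>y i\<close> and \<open>t i\<close> has to be broken, since a single surviving one would connect
  everything; hence \<open>W\<close> has at least \<open>n\<close> elements
  (\<open>removal_of_hubs_bound\<close>, \<open>surviving_hub_bound\<close>).

  Conversely, deleting \<open>X\<close> and \<open>m\<close> of the \<open>y i\<close> leaves at least \<open>m + 1\<close> components as long as the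
  clique is not used up (\<open>isolate_links\<close>). So the ratio \<open>(k + m) / (m + 1)\<close> is attained, and it is the
  toughness once it is minimal over \<open>m \<le> n\<close> and at most \<open>n / (k + 1)\<close>. For \<open>k = 2\<close>, \<open>n = 5\<close> the
  minimum is \<open>7/6\<close>, at \<open>m = 5\<close>, which requires a sixth clique vertex. For \<open>k = 1\<close> the ratio is always
  \<open>1\<close>, and \<open>m = 1\<close> is possible even when the clique is a triangle.
\<close>

section \<open>Counting components\<close>

lemma num_components_le_card:
  assumes "graph D" "finite R"
    and cover: "\<And>v. v \<in> verts D \<Longrightarrow> \<exists>r\<in>R. r \<rightarrow>\<^sup>*\<^bsub>D\<^esub> v"
  shows "num_components D \<le> card R"
proof -
  interpret graph D by fact
  have "sccs_verts \<subseteq> (\<lambda>r. {v. r \<rightarrow>\<^sup>*\<^bsub>D\<^esub> v}) ` R"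
  proof
    fix S assume S: "S \<in> sccs_verts"
    then obtain v where v: "v \<in> S" by (auto simp: in_sccs_verts_conv_reachable)
    then have "v \<rightarrow>\<^sup>*\<^bsub>D\<^esub> v" using S by (simp add: in_sccs_verts_conv_reachable)
    then obtain r where r: "r \<in> R" "r \<rightarrow>\<^sup>*\<^bsub>D\<^esub> v" using cover reachable_in_verts by blast
    have "S = {w. r \<rightarrow>\<^sup>*\<^bsub>D\<^esub> w}"
    proof (intro set_eqI iffI CollectI; (elim CollectE)?)
      fix w assume "w \<in> S"
      then have "v \<rightarrow>\<^sup>*\<^bsub>D\<^esub> w" using S v by (simp add: in_sccs_verts_conv_reachable)
      with r(2) show "r \<rightarrow>\<^sup>*\<^bsub>D\<^esub> w" by (rule reachable_trans)
    next
      fix w assume "r \<rightarrow>\<^sup>*\<^bsub>D\<^esub> w"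
      with symmetric_reachable'[OF r(2)] have "v \<rightarrow>\<^sup>*\<^bsub>D\<^esub> w" by (rule reachable_trans)
      then show "w \<in> S"
        using S v symmetric_reachable' unfolding in_sccs_verts_conv_reachable by blast
    qed
    then show "S \<in> (\<lambda>r. {v. r \<rightarrow>\<^sup>*\<^bsub>D\<^esub> v}) ` R" using r(1) by blast
  qed
  then have "card sccs_verts \<le> card R" using assms(2) by (rule surj_card_le[rotated])
  then show ?thesis by (simp add: num_components_conv_sccs[OF assms(1)] card_sccs_verts)
qed

text \<open>
  A labelling that is constant along arcs is constant on components, so distinct labels lie in
  distinct components.
\<close>

lemma card_labels_le_num_components:
  assumes "graph D" and const: "\<And>u v. u \<rightarrow>\<^bsub>D\<^esub> v \<Longrightarrow> f u = f v"
  shows "card (f ` verts D) \<le> num_components D"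
proof -
  interpret graph D by fact
  have reach: "f u = f v" if "u \<rightarrow>\<^sup>*\<^bsub>D\<^esub> v" for u v
    using that by (induct rule: reachable_induct) (auto dest: const)
  have "f ` verts D \<subseteq> (\<lambda>S. f (SOME v. v \<in> S)) ` sccs_verts"
  proof
    fix a assume "a \<in> f ` verts D"
    then obtain v where v: "v \<in> verts D" "a = f v" by blast
    let ?S = "{w. v \<rightarrow>\<^sup>*\<^bsub>D\<^esub> w}"
    have S: "?S \<in> sccs_verts"
      unfolding in_sccs_verts_conv_reachable
    proof (intro conjI ballI allI impI)
      show "?S \<noteq> {}" using v(1) by auto
      fix u w assume "u \<in> ?S"
      then have u: "v \<rightarrow>\<^sup>*\<^bsub>D\<^esub> u" by simp
      show "u \<rightarrow>\<^sup>*\<^bsub>D\<^esub> w" if "w \<in> ?S"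
        using that reachable_trans[OF symmetric_reachable'[OF u]] by simp
      show "\<not> u \<rightarrow>\<^sup>*\<^bsub>D\<^esub> w \<or> \<not> w \<rightarrow>\<^sup>*\<^bsub>D\<^esub> u" if "w \<notin> ?S"
        using that reachable_trans[OF u] by auto
    qed
    have "v \<in> ?S" using v(1) by simp
    then have "(SOME w. w \<in> ?S) \<in> ?S" by (rule someI[where P = "\<lambda>w. w \<in> ?S"])
    then have "a = f (SOME w. w \<in> ?S)" using reach[of v "SOME w. w \<in> ?S"] v(2) by simp
    then show "a \<in> (\<lambda>S. f (SOME v. v \<in> S)) ` sccs_verts" using S by (rule image_eqI)
  qed
  moreover have "finite sccs_verts"
  proof (rule finite_subset)
    show "sccs_verts \<subseteq> Pow (verts D)"
      unfolding sccs_verts_def using reachable_in_verts(1) by blast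
  qed simp
  ultimately have "card (f ` verts D) \<le> card sccs_verts" by (rule surj_card_le[rotated])
  then show ?thesis by (simp add: num_components_conv_sccs[OF assms(1)] card_sccs_verts)
qed

lemma verts_delete_verts: "verts (delete_verts G W) = verts G - W"
  by (simp add: delete_verts_def)

lemma graph_delete_verts:
  assumes "graph G" shows "graph (delete_verts G W)"
proof -
  interpret graph G by fact
  have "induced_subgraph (delete_verts G W) G"
    unfolding delete_verts_def by (intro induced_induce) auto
  then show ?thesis
    using digraph.graphI digraphI_induced induced_graph_imp_symmetric[OF sym_arcs] by blast
qed

lemma (in pair_graph) adj_delete_verts:
  "u \<rightarrow>\<^bsub>delete_verts (with_proj G) W\<^esub> v \<longleftrightarrow> (u, v) \<in> parcs G \<and> u \<notin> W \<and> v \<notin> W"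
  unfolding delete_verts_def
  by (auto simp: arcs_ends_conv dest: arc_fst_in_verts arc_snd_in_verts)

section \<open>A clique linked to outside vertices\<close>

text \<open>
  The vertices of \<open>X\<close> act as hubs for the links \<open>t i\<close>. The clique size \<open>p\<close> is independent of the
  number of links, so the \<open>y i\<close> may exhaust the clique.
\<close>

locale clique_with_hubs =
  fixes K :: "'a pair_pre_digraph" and p :: nat and X :: "'a set"
    and I :: "'i set" and y t :: "'i \<Rightarrow> 'a"
  assumes complete: "complete_digraph p (with_proj K)"
    and fin_X: "finite X" and fin_I: "finite I"
    and inj_y: "inj_on y I" and y_in: "y ` I \<subseteq> pverts K"
    and inj_t: "inj_on t I" and X_t: "X \<inter> t ` I = {}"
    and new: "(X \<union> t ` I) \<inter> pverts K = {}"
begin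

definition G :: "'a pair_pre_digraph" where
  "G = add_verts_edges K (X \<union> t ` I) ({(t i, x) | i x. i \<in> I \<and> x \<in> X} \<union> {(t i, y i) | i. i \<in> I})"

abbreviation rest :: "'a set \<Rightarrow> ('a, 'a \<times> 'a) pre_digraph" where
  "rest W \<equiv> delete_verts (with_proj G) W"

lemma finite_K: "finite (pverts K)" and card_K: "card (pverts K) = p"
  and arcs_K: "parcs K = {(u, v). u \<in> pverts K \<and> v \<in> pverts K \<and> u \<noteq> v}"
  using complete by (auto simp: complete_digraph_pair_def)

lemma verts_G: "pverts G = pverts K \<union> X \<union> t ` I"
  by (auto simp: G_def add_verts_edges_def)

lemma arcs_G: "(u, v) \<in> parcs G \<longleftrightarrow>
    u \<in> pverts K \<and> v \<in> pverts K \<and> u \<noteq> v \<or>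
    (\<exists>i\<in>I. u = t i \<and> (v \<in> X \<or> v = y i) \<or> v = t i \<and> (u \<in> X \<or> u = y i))"
  by (auto simp: G_def add_verts_edges_def arcs_K)

sublocale pair_graph G
  unfolding G_def
proof (rule pair_graph_add_verts_edges[OF complete], goal_cases)
  case 1 show ?case using fin_X fin_I by simp
next
  case 2 show ?case
    by (rule finite_subset[of _ "t ` I \<times> (X \<union> y ` I)"]) (use fin_X fin_I in auto)
next
  case (3 a b) then show ?case using y_in X_t new by blast
qed

lemma graph_G: "graph (with_proj G)" by unfold_locales

lemma graph_rest: "graph (rest W)" using graph_G by (rule graph_delete_verts)

lemma verts_rest: "verts (rest W) = (pverts K \<union> X \<union> t ` I) - W"
  by (simp add: verts_delete_verts verts_G)

lemmas adj_rest = adj_delete_verts[unfolded arcs_G]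

text \<open>
  If the whole clique is deleted, any vertex will do as \<open>k\<close>; this spares a case distinction when the
  components are counted.
\<close>

lemma clique_representative:
  "\<exists>k. \<forall>v \<in> pverts K - W. k \<rightarrow>\<^sup>*\<^bsub>rest W\<^esub> v"
proof (cases "pverts K - W = {}")
  case False
  then obtain k where k: "k \<in> pverts K - W" by blast
  interpret D: graph "rest W" by (rule graph_rest)
  have "k \<rightarrow>\<^sup>*\<^bsub>rest W\<^esub> v" if "v \<in> pverts K - W" for v
  proof (cases "v = k")
    case True then show ?thesis using k by (simp add: verts_rest)
  next
    case False then show ?thesis using k that by (intro D.reachable_adjI) (auto simp: adj_rest)
  qed
  then show ?thesis by blast
qed auto

text \<open>
  Here \<open>m\<close> is the number of links that the deletion cuts off completely: they survive and lose their
  clique neighbour. Each costs one deleted \<open>y i\<close> and yields one component; the remaining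
  links stay attached to what is left of the clique.
\<close>

lemma removal_of_hubs_bound:
  assumes W: "W \<subseteq> pverts G" and X: "X \<subseteq> W"
  obtains m where "m \<le> card I" "num_components (rest W) \<le> m + 1" "card X + m \<le> card W"
proof -
  interpret D: graph "rest W" by (rule graph_rest)
  define M where "M = {i \<in> I. t i \<notin> W \<and> y i \<in> W}"
  have M: "M \<subseteq> I" by (auto simp: M_def)
  then have fin_M: "finite M" using fin_I finite_subset by blast
  obtain k where k: "\<And>v. v \<in> pverts K - W \<Longrightarrow> k \<rightarrow>\<^sup>*\<^bsub>rest W\<^esub> v" using clique_representative[of W] by blast
  have "num_components (rest W) \<le> card (insert k (t ` M))"
  proof (rule num_components_le_card[OF graph_rest])
    fix v assume v: "v \<in> verts (rest W)"
    then consider "v \<in> pverts K - W" | i where "i \<in> I" "v = t i" "t i \<notin> W"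
      using X by (auto simp: verts_rest)
    then show "\<exists>r\<in>insert k (t ` M). r \<rightarrow>\<^sup>*\<^bsub>rest W\<^esub> v"
    proof cases
      case 1 then show ?thesis using k by blast
    next
      case 2
      show ?thesis
      proof (cases "y i \<in> W")
        case True
        then have "v \<in> t ` M" using 2 by (auto simp: M_def)
        then show ?thesis using v by auto
      next
        case False
        then have "k \<rightarrow>\<^sup>*\<^bsub>rest W\<^esub> y i" using k 2 y_in by blast
        also have "y i \<rightarrow>\<^bsub>rest W\<^esub> v" using False 2 by (auto simp: adj_rest)
        finally show ?thesis by blast
      qed
    qed
  qed (use fin_M in simp)
  also have "\<dots> \<le> card M + 1"
    using card_insert_le_m1 card_image_le[OF fin_M, of t] by (simp add: card_insert_if fin_M)
  finally have "num_components (rest W) \<le> card M + 1" .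
  moreover have "card X + card M \<le> card W"
  proof -
    have "card X + card M = card X + card (y ` M)"
      using card_image inj_on_subset[OF inj_y M] by metis
    also have "\<dots> = card (X \<union> y ` M)"
      using fin_X fin_M y_in new M by (subst card_Un_disjoint) auto
    also have "\<dots> \<le> card W"
      using X finite_subset[OF W pair_finite_verts] by (intro card_mono) (auto simp: M_def)
    finally show ?thesis .
  qed
  moreover have "card M \<le> card I" using M fin_I by (rule card_mono[rotated])
  ultimately show ?thesis using that by blast
qed

text \<open>
  A surviving hub absorbs all surviving links, so components are met by the clique or by a hub.
  If some \<open>t i\<close> and \<open>y i\<close> both survived, then this link would be joined to every surviving hub and to the
  rest of the clique, leaving one component only; so a cutset meets each of the disjoint pairs
  \<open>{t i, y i}\<close>.
\<close>

lemma surviving_hub_bound: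
  assumes W: "cutset (with_proj G) W" and X: "\<not> X \<subseteq> W"
  shows "num_components (rest W) \<le> card X + 1" "card I \<le> card W"
proof -
  interpret D: graph "rest W" by (rule graph_rest)
  obtain h where h: "h \<in> X" "h \<notin> W" using X by blast
  have fin_W: "finite W" using W finite_subset[OF _ pair_finite_verts] by (simp add: cutset_def)
  have two: "2 \<le> num_components (rest W)" using W by (simp add: cutset_def)
  obtain k where k: "\<And>v. v \<in> pverts K - W \<Longrightarrow> k \<rightarrow>\<^sup>*\<^bsub>rest W\<^esub> v" using clique_representative[of W] by blast
  have link: "h \<rightarrow>\<^bsub>rest W\<^esub> t i" if "i \<in> I" "t i \<notin> W" for i
    using h that by (auto simp: adj_rest)
  have "num_components (rest W) \<le> card (insert k X)"
  proof (rule num_components_le_card[OF graph_rest])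
    fix v assume v: "v \<in> verts (rest W)"
    then consider "v \<in> pverts K - W" | "v \<in> X" | i where "i \<in> I" "v = t i" "t i \<notin> W"
      by (auto simp: verts_rest)
    then show "\<exists>r\<in>insert k X. r \<rightarrow>\<^sup>*\<^bsub>rest W\<^esub> v"
    proof cases
      case 1 then show ?thesis using k by blast
    next
      case 2 then show ?thesis using v by auto
    next
      case 3 then show ?thesis using link[of i] h by blast
    qed
  qed (use fin_X in simp)
  also have "\<dots> \<le> card X + 1" using fin_X by (simp add: card_insert_if)
  finally show "num_components (rest W) \<le> card X + 1" .
  have hit: "t i \<in> W \<or> y i \<in> W" if i: "i \<in> I" for i
  proof (rule ccontr)
    assume "\<not> ?thesis"
    then have out: "t i \<notin> W" "y i \<notin> W" by auto
    have "num_components (rest W) \<le> card {t i}"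
    proof (rule num_components_le_card[OF graph_rest])
      have t_y: "t i \<rightarrow>\<^bsub>rest W\<^esub> y i" using i out by (auto simp: adj_rest)
      have t_X: "t i \<rightarrow>\<^bsub>rest W\<^esub> x" if "x \<in> X" "x \<notin> W" for x
        using i out that by (auto simp: adj_rest)
      fix v assume "v \<in> verts (rest W)"
      then consider "v \<in> pverts K - W" | "v \<in> X" "v \<notin> W" | j where "j \<in> I" "v = t j" "t j \<notin> W"
        by (auto simp: verts_rest)
      then have "t i \<rightarrow>\<^sup>*\<^bsub>rest W\<^esub> v"
      proof cases
        case 1
        have "y i \<in> pverts K - W" using i out y_in by blast
        then have "y i \<rightarrow>\<^sup>*\<^bsub>rest W\<^esub> k" using k D.symmetric_reachable' by blast
        also have "k \<rightarrow>\<^sup>*\<^bsub>rest W\<^esub> v" using 1 k by blast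
        finally show ?thesis using t_y D.adj_reachable_trans by blast
      next
        case 2 then show ?thesis using t_X by blast
      next
        case 3
        have "t i \<rightarrow>\<^bsub>rest W\<^esub> h" using t_X h by blast
        also have "h \<rightarrow>\<^bsub>rest W\<^esub> v" using link 3 by blast
        finally show ?thesis by blast
      qed
      then show "\<exists>r\<in>{t i}. r \<rightarrow>\<^sup>*\<^bsub>rest W\<^esub> v" by blast
    qed simp
    then show False using two by simp
  qed
  let ?g = "\<lambda>i. if t i \<in> W then t i else y i"
  have "inj_on ?g I"
  proof (rule inj_onI)
    fix i j assume ij: "i \<in> I" "j \<in> I" "?g i = ?g j"
    have "t a \<noteq> y b" if "a \<in> I" "b \<in> I" for a b
      using that new y_in by (metis IntI UnI2 empty_iff image_eqI subsetD)
    then show "i = j"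
      using ij inj_onD[OF inj_y, of i j] inj_onD[OF inj_t, of i j]
      by (metis (full_types))
  qed
  moreover have "?g ` I \<subseteq> W" using hit by auto
  ultimately show "card I \<le> card W" using fin_W by (rule card_inj_on_le)
qed

text \<open>
  The bound \<open>card J < p\<close> keeps a clique vertex alive, which accounts for the component beyond the
  isolated links.
\<close>

lemma isolate_links:
  assumes J: "J \<subseteq> I" and p: "card J < p"
  shows "card J + 1 \<le> num_components (rest (X \<union> y ` J))"
    and "card (X \<union> y ` J) = card X + card J"
proof -
  have fin_J: "finite J" using J fin_I finite_subset by blast
  have card_y: "card (y ` J) = card J" using card_image inj_on_subset[OF inj_y J] by blast
  have card_t: "card (t ` J) = card J" using card_image inj_on_subset[OF inj_t J] by blast
  show "card (X \<union> y ` J) = card X + card J"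
    using fin_X fin_J y_in new J card_y by (subst card_Un_disjoint) auto
  have "\<not> pverts K \<subseteq> y ` J"
    using card_mono[of "y ` J" "pverts K"] fin_J p card_y card_K by auto
  then obtain k where k: "k \<in> pverts K" "k \<notin> y ` J" by blast
  let ?D = "rest (X \<union> y ` J)"
  \<comment> \<open>Each isolated link is its own label; everything else shares the label \<open>None\<close>.\<close>
  let ?f = "\<lambda>v. if v \<in> t ` J then Some v else None"
  have "None \<in> ?f ` verts ?D"
  proof (rule image_eqI)
    show "k \<in> verts ?D" using k new by (auto simp: verts_rest)
    show "None = ?f k" using k new J by auto
  qed
  moreover have "Some v \<in> ?f ` verts ?D" if v: "v \<in> t ` J" for v
  proof (rule image_eqI)
    have "v \<in> t ` I" using v J by blast
    moreover from this have "v \<notin> X" "v \<notin> y ` J" using J X_t new y_in by blast+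
    ultimately show "v \<in> verts ?D" by (simp add: verts_rest)
    show "Some v = ?f v" using v by simp
  qed
  ultimately have "insert None (Some ` t ` J) \<subseteq> ?f ` verts ?D" by blast
  then have "card (insert None (Some ` t ` J)) \<le> card (?f ` verts ?D)"
    by (rule card_mono[rotated]) (use finite_K fin_X fin_I in \<open>simp add: verts_rest\<close>)
  also have "\<dots> \<le> num_components ?D"
  proof (rule card_labels_le_num_components[OF graph_rest])
    fix u v assume uv: "u \<rightarrow>\<^bsub>?D\<^esub> v"
    have "u \<notin> t ` J \<and> v \<notin> t ` J"
    proof -
      have out: "u \<notin> X \<union> y ` J" "v \<notin> X \<union> y ` J" using uv by (simp_all add: adj_delete_verts)
      have no: "w \<notin> pverts K" "w \<notin> X" "w \<notin> y ` I" if "w \<in> t ` I" for w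
        using that X_t new y_in by blast+
      have "b \<in> X \<union> y ` J"
        if b: "(a, b) \<in> parcs G \<or> (b, a) \<in> parcs G" and a: "a \<in> t ` J" for a b
      proof -
        obtain j where j: "j \<in> J" "a = t j" using a by blast
        then have aI: "a \<in> t ` I" using J by blast
        obtain i where "i \<in> I" "a = t i" "b \<in> X \<or> b = y i"
          using b no[OF aI] unfolding arcs_G by blast
        moreover from this have "i = j" using j J inj_t by (auto dest: inj_onD)
        ultimately show ?thesis using j(1) by blast
      qed
      moreover have "(u, v) \<in> parcs G" using uv by (simp add: adj_delete_verts)
      ultimately show ?thesis using out by blast
    qed
    then show "?f u = ?f v" by simp
  qed
  finally show "card J + 1 \<le> num_components ?D"
    using fin_J card_t by (simp add: card_image)
qed

lemma tough_G:
  assumes s: "0 \<le> s" and hub: "s * real (card X + 1) \<le> real (card I)"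
    and links: "\<And>m. m \<le> card I \<Longrightarrow> s * real (m + 1) \<le> real (card X + m)"
  shows "tough s (with_proj G)"
  unfolding tough_def
proof (intro allI impI)
  fix W assume W: "cutset (with_proj G) W"
  obtain a where c: "num_components (rest W) \<le> a" and a: "s * real a \<le> real (card W)"
  proof (cases "X \<subseteq> W")
    case True
    obtain m where m: "m \<le> card I" "num_components (rest W) \<le> m + 1" "card X + m \<le> card W"
      using removal_of_hubs_bound[OF _ True] W by (auto simp: cutset_def)
    have "s * real (m + 1) \<le> real (card W)"
      using links[OF m(1)] m(3) by linarith
    then show ?thesis using that m(2) by blast
  next
    case False
    note b = surviving_hub_bound[OF W False]
    have "s * real (card X + 1) \<le> real (card W)" using hub b(2) by linarith
    then show ?thesis using that b(1) by blast
  qed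
  have "s * real (num_components (rest W)) \<le> s * real a" using c s by (intro mult_left_mono) auto
  then show "s * real (num_components (rest W)) \<le> real (card W)" using a by linarith
qed

text \<open>
  The set \<open>J\<close> picks the links whose isolation attains the least ratio. It must be nonempty, since
  deleting the hubs alone need not disconnect the graph.
\<close>

theorem toughness_G:
  assumes J: "J \<subseteq> I" "J \<noteq> {}" "card J < p"
    and attained: "s * real (card J + 1) = real (card X + card J)"
    and hub: "s * real (card X + 1) \<le> real (card I)"
    and links: "\<And>m. m \<le> card I \<Longrightarrow> s * real (m + 1) \<le> real (card X + m)"
  shows "toughness (with_proj G) = s"
  unfolding toughness_def
proof (rule Greatest_equality)
  have s: "0 \<le> s"
    using attained zero_le_mult_iff[of s "real (card J + 1)"] by auto
  show "tough s (with_proj G)" using s hub links by (rule tough_G)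
  fix r assume r: "tough r (with_proj G)"
  let ?W = "X \<union> y ` J"
  note iso = isolate_links[OF J(1,3)]
  have "1 \<le> card J" using J fin_I by (simp add: Suc_le_eq card_gt_0_iff finite_subset)
  then have "cutset (with_proj G) ?W"
    using iso(1) J(1) y_in by (auto simp: cutset_def verts_G)
  then have *: "r * real (num_components (rest ?W)) \<le> real (card X + card J)"
    using r iso(2) by (auto simp: tough_def)
  show "r \<le> s"
  proof (cases "0 \<le> r")
    case True
    have "r * real (card J + 1) \<le> r * real (num_components (rest ?W))"
      using True iso(1) by (intro mult_left_mono) auto
    then have "r * real (card J + 1) \<le> s * real (card J + 1)" using * attained by linarith
    then show ?thesis by (rule mult_right_le_imp_le) simp
  qed (use s in simp)
qed

end

section \<open>The two families\<close>

lemma toughness_H5: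
  assumes "6 \<le> p" "is_H5 p G"
  shows "toughness (with_proj G) = 7 / 6"
proof -
  obtain K y x t where H: "complete_digraph p (with_proj K)"
    "inj_on y {1..5::nat}" "y ` {1..5} \<subseteq> pverts K"
    "inj_on x {1..2::nat}" "inj_on t {1..5::nat}" "x ` {1..2} \<inter> t ` {1..5} = {}"
    "(x ` {1..2} \<union> t ` {1..5}) \<inter> pverts K = {}"
    and G: "G = add_verts_edges K (x ` {1..2} \<union> t ` {1..5})
           ({(t i, x j) | i j. i \<in> {1..5} \<and> j \<in> {1..2}} \<union> {(t i, y i) | i. i \<in> {1..5}})"
    using assms(2) unfolding is_H5_def by blast
  interpret H: clique_with_hubs K p "x ` {1..2}" "{1..5}" y t
    using H by unfold_locales auto
  have "{(t i, x j) | i j. i \<in> {1..5} \<and> j \<in> {1..2}} =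
      {(t i, v) | i v. i \<in> {1..5} \<and> v \<in> x ` {1..2}}" by blast
  then have "G = H.G" unfolding G H.G_def by simp
  moreover have "card (x ` {1..2}) = 2" using card_image[OF H(4)] by simp
  ultimately show ?thesis
    using assms(1) by (simp only:, intro H.toughness_G[of "{1..5}"]) auto
qed

lemma toughness_H12:
  assumes "3 \<le> p" "is_H12 p G"
  shows "toughness (with_proj G) = 1"
proof -
  obtain K y x t where H: "complete_digraph p (with_proj K)"
    "inj_on y {1..3::nat}" "y ` {1..3} \<subseteq> pverts K"
    "inj_on t {1..3::nat}" "x \<notin> t ` {1..3}" "insert x (t ` {1..3}) \<inter> pverts K = {}"
    and G: "G = add_verts_edges K (insert x (t ` {1..3}))
           ({(t i, x) | i. i \<in> {1..3}} \<union> {(t i, y i) | i. i \<in> {1..3}})"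
    using assms(2) unfolding is_H12_def by blast
  interpret H: clique_with_hubs K p "{x}" "{1..3}" y t
    using H by unfold_locales auto
  have "{(t i, x) | i. i \<in> {1..3}} = {(t i, v) | i v. i \<in> {1..3} \<and> v \<in> {x}}" by blast
  then have "G = H.G" unfolding G H.G_def by simp
  then show ?thesis
    using assms(1) by (simp only:, intro H.toughness_G[of "{1}"]) auto
qed

theorem theorem6:
  shows "(\<forall>p (G :: 'a pair_pre_digraph). p \<ge> 6 \<longrightarrow> is_H5 p G \<longrightarrow> toughness (with_proj G) = 7 / 6) \<and>
         (\<forall>p (G :: 'a pair_pre_digraph). p \<ge> 3 \<longrightarrow> is_H12 p G \<longrightarrow> toughness (with_proj G) = 1)"
  using toughness_H5 toughness_H12 by blast

end
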